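(* In the setting fixed in the context, suppose that $$\int_{t_0}^{+\infty}\epsilon(t)\,dt<+\infty,\qquad \lim_{t\to+\infty}\beta(t)=+\infty,\qquad \dot\beta(t)\le\frac1\delta\beta(t)\ \text{ for all } t\ge t_0,\qquad \frac1\delta\le\gamma .$$ Let $(x,y,\lambda):[t_0,+\infty)\to\mathcal{X}\times\mathcal{Y}\times\mathcal{Z}$ be a solution of the dynamical system (DS). Then $$\lim_{t\to+\infty}\mathcal{L}(x(t),y(t),\lambda^* )=\mathcal{L}(x^*,y^*,\lambda^* ),\qquad\forall\,(x^*,y^*,\lambda^* )\in\Omega .$$
   Context: Let $\mathcal{X},\mathcal{Y},\mathcal{Z}$ be real Hilbert spaces, $A:\mathcal{X}\to\mathcal{Z}$ and $B:\mathcal{Y}\to\mathcal{Z}$ continuous linear operators with adjoints $A^\top,B^\top$, and $b\in\mathcal{Z}$. Let $f:\mathcal{X}\to\mathbb{R}$ and $g:\mathcal{Y}\to\mathbb{R}$ be continuously differentiable convex functions, with $\nabla f$ $l_1$-Lipschitz continuous ($l_1>0$) and $\nabla g$ $l_2$-Lipschitz continuous ($l_2>0$). The problem under study is to minimize $f(x)+g(y)$ over $(x,y)\in\mathcal{X}\times\mathcal{Y}$ subject to $Ax+By=b$. The augmented Lagrangian is $$\mathcal{L}(x,y,\lambda)=f(x)+g(y)+\langle\lambda,Ax+By-b\rangle+\tfrac12\|Ax+By-b\|^2 .$$ $\Omega$ denotes its set of saddle points: $(x^*,y^*,\lambda^* )\in\Omega$ iff $\mathcal{L}(x^*,y^*,\lambda)\le\mathcal{L}(x^*,y^*,\lambda^*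 )\le\mathcal{L}(x,y,\lambda^* )$ for all $(x,y,\lambda)\in\mathcal{X}\times\mathcal{Y}\times\mathcal{Z}$; equivalently $-A^\top\lambda^*=\nabla f(x^* )$, $-B^\top\lambda^*=\nabla g(y^* )$, $Ax^*+By^*=b$. It is assumed that $\Omega\neq\emptyset$. Let $t_0>0$, $\gamma>0$, $\delta>0$ be constants; $\beta:[t_0,+\infty)\to(0,+\infty)$ is non-decreasing and continuously differentiable; $\epsilon:[t_0,+\infty)\to[0,+\infty)$ is non-increasing and continuously differentiable with $\lim_{t\to+\infty}\epsilon(t)=0$. The dynamical system (DS) is, for $t\ge t_0$, $$\begin{cases}\ddot{x}(t)+\gamma\dot{x}(t)+\beta(t)\big(\nabla f(x(t))+A^\top\lambda(t)+A^\top(Ax(t)+By(t)-b)+\epsilon(t)x(t)\big)=0,\\ \ddot{y}(t)+\gamma\dot{y}(t)+\beta(t)\big(\nabla g(y(t))+B^\top\lambda(t)+B^\top(Ax(t)+By(t)-b)+\epsilon(t)y(t)\big)=0,\\ \dot{\lambda}(t)-\beta(t)\big(A(x(t)+\delta\dot{x}(t))+B(y(t)+\delta\dot{y}(t))-b\big)=0,\end{cases}$$ and a solution is a triple $(x,y,\lambda)$ with $x,y$ twice differentiable and $\lambda$ differentiable satisfying these equations for all $t\ge t_0$. *)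

theory Defs
  imports "HOL-Analysis.Analysis"
begin

text \<open>
  Real Hilbert spaces are types of sort \<open>{real_inner, complete_space}\<close>. For continuous linear
  maps between them, the library constant \<^const>\<open>adjoint\<close> is the Hilbert space adjoint: by the
  Riesz representation theorem a map satisfying its defining identity exists, and it is unique.
\<close>

definition aug_lagrangian ::
  "('x::real_inner \<Rightarrow> real) \<Rightarrow> ('y::real_inner \<Rightarrow> real) \<Rightarrow> ('x \<Rightarrow> 'z) \<Rightarrow> ('y \<Rightarrow> 'z) \<Rightarrow> 'z::real_inner
    \<Rightarrow> 'x \<Rightarrow> 'y \<Rightarrow> 'z \<Rightarrow> real" where
  "aug_lagrangian f g A B b x y l =
     f x + g y + l \<bullet> (A x + B y - b) + 1/2 * (norm (A x + B y - b))\<^sup>2"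

definition saddle_points ::
  "('x::real_inner \<Rightarrow> real) \<Rightarrow> ('y::real_inner \<Rightarrow> real) \<Rightarrow> ('x \<Rightarrow> 'z) \<Rightarrow> ('y \<Rightarrow> 'z) \<Rightarrow> 'z::real_inner
    \<Rightarrow> ('x \<times> 'y \<times> 'z) set" where
  "saddle_points f g A B b =
     {(xs, ys, ls). \<forall>x y l.
        aug_lagrangian f g A B b xs ys l \<le> aug_lagrangian f g A B b xs ys ls \<and>
        aug_lagrangian f g A B b xs ys ls \<le> aug_lagrangian f g A B b x y ls}"

text \<open>
  Here \<open>gradf\<close>, \<open>gradg\<close> stand for the gradients of the objective functions. The trajectories are total
  functions on the reals of which only the values on \<open>{t0..}\<close> matter; accordingly, all derivatives
  are taken within \<open>{t0..}\<close>, hence are one-sided at \<open>t0\<close>.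
\<close>

definition DS_solution ::
  "('x::{real_inner,complete_space} \<Rightarrow> 'x) \<Rightarrow> ('y::{real_inner,complete_space} \<Rightarrow> 'y)
    \<Rightarrow> ('x \<Rightarrow> 'z) \<Rightarrow> ('y \<Rightarrow> 'z) \<Rightarrow> 'z::{real_inner,complete_space}
    \<Rightarrow> real \<Rightarrow> real \<Rightarrow> real \<Rightarrow> (real \<Rightarrow> real) \<Rightarrow> (real \<Rightarrow> real)
    \<Rightarrow> (real \<Rightarrow> 'x) \<Rightarrow> (real \<Rightarrow> 'y) \<Rightarrow> (real \<Rightarrow> 'z) \<Rightarrow> bool" where
  "DS_solution gradf gradg A B b t0 \<gamma> \<delta> \<beta> \<epsilon> x y l \<longleftrightarrow>
     (\<exists>x' x'' y' y'' l'. \<forall>t\<ge>t0.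
        (x has_vector_derivative x' t) (at t within {t0..}) \<and>
        (x' has_vector_derivative x'' t) (at t within {t0..}) \<and>
        (y has_vector_derivative y' t) (at t within {t0..}) \<and>
        (y' has_vector_derivative y'' t) (at t within {t0..}) \<and>
        (l has_vector_derivative l' t) (at t within {t0..}) \<and>
        x'' t + \<gamma> *\<^sub>R x' t
          + \<beta> t *\<^sub>R (gradf (x t) + adjoint A (l t) + adjoint A (A (x t) + B (y t) - b)
                    + \<epsilon> t *\<^sub>R x t) = 0 \<and>
        y'' t + \<gamma> *\<^sub>R y' t
          + \<beta> t *\<^sub>R (gradg (y t) + adjoint B (l t) + adjoint B (A (x t) + B (y t) - b)
                    + \<epsilon> t *\<^sub>R y t) = 0 \<and>
        l' t - \<beta> t *\<^sub>R (A (x t + \<delta> *\<^sub>R x' t) + B (y t + \<delta> *\<^sub>R y' t) - b) = 0)"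

end

theory Submission
  imports Defs
begin

text \<open>
  Write \<open>X = (x, y)\<close>, \<open>p = (x\<^sup>*, y\<^sup>*)\<close> and \<open>P\<close> for the gap \<open>L(X, \<lambda>\<^sup>*) - L(p, \<lambda>\<^sup>*)\<close>, a nonnegative convex
  function. Along the trajectory the energy
  \<open>E = \<delta>\<^sup>2 \<beta> (P + \<epsilon>/2 |X|\<^sup>2) + 1/2 |X - p + \<delta> X'|\<^sup>2 + (\<delta> \<gamma> - 1)/2 |X - p|\<^sup>2 + \<delta>/2 |\<lambda> - \<lambda>\<^sup>*|\<^sup>2\<close>
  satisfies \<open>E' \<le> (\<delta>/2) |p|\<^sup>2 \<beta> \<epsilon>\<close>: the terms pairing \<open>\<lambda> - \<lambda>\<^sup>*\<close> with the constraint cancel, convexity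
  bounds the gradient term by \<open>- \<delta> \<beta> (P + \<epsilon>/2 |X|\<^sup>2)\<close> up to the right-hand side, and
  \<open>\<delta> \<beta>' \<le> \<beta>\<close> absorbs the growth of \<open>\<beta>\<close>. Since \<open>\<epsilon>\<close> is integrable and \<open>\<beta>\<close> increases to infinity,
  \<open>\<delta>\<^sup>2 P \<le> E / \<beta>\<close> tends to zero.
\<close>

section \<open>Convexity and Hilbert space preliminaries\<close>

text \<open>Along the segment from \<open>u\<close> to \<open>v\<close>, convexity bounds each
  difference quotient by \<open>f v - f u\<close>; as \<open>s\<close> decreases to 0 the quotients
  tend to the directional derivative.\<close>

lemma convex_on_gderiv_inequality:
  assumes "convex_on UNIV f" and "GDERIV f u :> D"
  shows "f v \<ge> f u + (v - u) \<bullet> D"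
proof -
  define \<phi> where "\<phi> s = f (u + s *\<^sub>R (v - u))" for s :: real
  have "(\<phi> has_derivative (\<lambda>s. (s *\<^sub>R (v - u)) \<bullet> D)) (at 0)"
  proof -
    have "((\<lambda>s::real. u + s *\<^sub>R (v - u)) has_derivative (\<lambda>s. s *\<^sub>R (v - u))) (at 0)"
      by (auto intro!: derivative_eq_intros)
    moreover have "(f has_derivative (\<lambda>h. h \<bullet> D)) (at (u + (0::real) *\<^sub>R (v - u)))"
      using assms(2) by (simp add: gderiv_def)
    ultimately show ?thesis
      unfolding \<phi>_def by (rule has_derivative_compose)
  qed
  then have "(\<phi> has_real_derivative ((v - u) \<bullet> D)) (at 0)"
    by (simp add: has_field_derivative_def mult_commute_abs)
  then have lim: "((\<lambda>s. (\<phi> s - \<phi> 0) / s) \<longlongrightarrow> (v - u) \<bullet> D) (at_right 0)"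
    by (auto simp: has_field_derivative_iff intro: filterlim_mono at_le)
  have "(\<phi> s - \<phi> 0) / s \<le> f v - f u" if "0 < s" "s < 1" for s
  proof -
    have "\<phi> s = f ((1 - s) *\<^sub>R u + s *\<^sub>R v)"
      by (simp add: \<phi>_def algebra_simps)
    also have "\<dots> \<le> (1 - s) * f u + s * f v"
      using that by (intro convex_onD[OF assms(1)]) auto
    finally show ?thesis
      using that by (simp add: \<phi>_def field_simps)
  qed
  then have "\<forall>\<^sub>F s in at_right 0. (\<phi> s - \<phi> 0) / s \<le> f v - f u"
    unfolding eventually_at_right_field by (intro exI[of _ 1]) auto
  from tendsto_upperbound[OF lim this] show ?thesis by simp
qed

lemma parallelogram_law:
  fixes u v :: "'a::real_inner"
  shows "(norm (u - v))\<^sup>2 + (norm (u + v))\<^sup>2 = 2 * (norm u)\<^sup>2 + 2 * (norm v)\<^sup>2"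
  by (simp add: power2_norm_eq_inner algebra_simps)

text \<open>The representing vector is the minimiser of \<open>norm u ^ 2 - 2 * \<phi> u\<close>, whose minimising
  sequences are Cauchy by the parallelogram law.\<close>

lemma riesz_representation:
  fixes \<phi> :: "'a::{real_inner,complete_space} \<Rightarrow> real"
  assumes "bounded_linear \<phi>"
  shows "\<exists>a. \<forall>u. \<phi> u = u \<bullet> a"
proof -
  interpret \<phi>: bounded_linear \<phi> by fact
  define J where "J u = (norm u)\<^sup>2 - 2 * \<phi> u" for u
  obtain C where C: "\<And>u. \<bar>\<phi> u\<bar> \<le> norm u * C"
    using \<phi>.bounded by auto
  have bdd: "bdd_below (range J)"
  proof (rule bdd_belowI2)
    fix u :: 'a
    \<comment> \<open>Completing the square in \<open>norm u\<close> shows that the quadratic term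
      dominates the linear one.\<close>
    have "0 \<le> (norm u - C)\<^sup>2" by simp
    also have "\<dots> = (norm u)\<^sup>2 - 2 * (norm u * C) + C\<^sup>2"
      by (simp add: power2_diff)
    finally show "- C\<^sup>2 \<le> J u"
      using C[of u] unfolding J_def by linarith
  qed
  define m where "m = Inf (range J)"
  have m: "m \<le> J u" for u
    unfolding m_def using bdd by (intro cInf_lower) auto
  have "\<exists>u. J u < m + inverse (real (Suc n))" for n
  proof -
    have "Inf (range J) < m + inverse (real (Suc n))"
      by (simp add: m_def)
    then show ?thesis
      using cInf_lessD[of "range J"] by blast
  qed
  then obtain s where s: "\<And>n. J (s n) < m + inverse (real (Suc n))"
    by metis
  \<comment> \<open>The midpoint of \<open>u\<close> and \<open>v\<close> has value at least
    \<open>m\<close>; in the parallelogram law the linear parts of \<open>J\<close> cancel, so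
    near-minimisers lie close together.\<close>
  have dist: "(norm (u - v))\<^sup>2 \<le> 2 * (J u - m) + 2 * (J v - m)" for u v
  proof -
    have "(norm ((1/2) *\<^sub>R (u + v)))\<^sup>2 = (norm (u + v))\<^sup>2 / 4"
      by (simp only: norm_scaleR) (simp add: power_divide)
    moreover have "\<phi> ((1/2) *\<^sub>R (u + v)) = (\<phi> u + \<phi> v) / 2"
      by (simp only: \<phi>.scaleR \<phi>.add) simp
    ultimately have "4 * J ((1/2) *\<^sub>R (u + v)) = (norm (u + v))\<^sup>2 - 4 * \<phi> u - 4 * \<phi> v"
      by (simp add: J_def)
    then show ?thesis
      using m[of "(1/2) *\<^sub>R (u + v)"] parallelogram_law[of u v]
      by (simp add: J_def)
  qed
  have "Cauchy s"
  proof (rule metric_CauchyI)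
    fix e :: real assume "e > 0"
    then obtain N where N: "inverse (real (Suc N)) < e\<^sup>2 / 4"
      using reals_Archimedean[of "e\<^sup>2 / 4"] by auto
    have small: "J (s n) - m < e\<^sup>2 / 4" if "n \<ge> N" for n
    proof -
      have "inverse (real (Suc n)) \<le> inverse (real (Suc N))"
        using that by (intro le_imp_inverse_le) auto
      then show ?thesis using s[of n] N by linarith
    qed
    show "\<exists>N. \<forall>k\<ge>N. \<forall>n\<ge>N. dist (s k) (s n) < e"
    proof (intro exI[of _ N] allI impI)
      fix k n assume "N \<le> k" "N \<le> n"
      then have "(norm (s k - s n))\<^sup>2 < e\<^sup>2"
        using dist[of "s k" "s n"] small[of k] small[of n] by auto
      then show "dist (s k) (s n) < e"
        using \<open>e > 0\<close> by (simp add: dist_norm power2_less_imp_less)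
    qed
  qed
  then obtain a where a: "s \<longlonglongrightarrow> a"
    by (auto simp: Cauchy_convergent_iff convergent_def)
  have "(\<lambda>n. J (s n)) \<longlonglongrightarrow> J a"
    unfolding J_def by (intro tendsto_intros a \<phi>.tendsto)
  moreover have "(\<lambda>n. m + inverse (real (Suc n))) \<longlonglongrightarrow> m"
    using LIMSEQ_inverse_real_of_nat_add[of m] by simp
  ultimately have Ja: "J a \<le> m"
    using s by (intro LIMSEQ_le) (auto intro: less_imp_le)
  have "\<phi> u = u \<bullet> a" for u
  proof (cases "u = 0")
    case False
    \<comment> \<open>This \<open>c\<close> minimises the quadratic
      \<open>J (a - c *\<^sub>R u)\<close> over step lengths. Its value lies below
      \<open>J a\<close> by \<open>c\<^sup>2 * (u \<bullet> u)\<close>, so minimality of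
      \<open>a\<close> forces \<open>c = 0\<close>.\<close>
    define c where "c = (u \<bullet> a - \<phi> u) / (u \<bullet> u)"
    have uu: "u \<bullet> u > 0" using False by simp
    then have cu: "c * (u \<bullet> u) = u \<bullet> a - \<phi> u"
      by (simp add: c_def)
    have "J (a - c *\<^sub>R u) = J a + c * (c * (u \<bullet> u)) - 2 * c * (u \<bullet> a - \<phi> u)"
      by (simp add: J_def power2_norm_eq_inner algebra_simps inner_commute \<phi>.diff \<phi>.scaleR)
    also have "\<dots> = J a - c * (c * (u \<bullet> u))"
      unfolding cu by simp
    finally have "c\<^sup>2 * (u \<bullet> u) \<le> 0"
      using m[of "a - c *\<^sub>R u"] Ja by (simp add: power2_eq_square mult.assoc)
    then have "c = 0"
      using uu by (simp add: mult_le_0_iff)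
    then show ?thesis
      using cu by simp
  qed simp
  then show ?thesis by blast
qed

text \<open>The constant \<open>adjoint\<close> chooses a map with the defining identity, so the
  identity holds once such a map exists; representing \<open>A u \<bullet> v\<close> as a functional
  of \<open>u\<close> provides one.\<close>

lemma inner_adjoint_right:
  fixes A :: "'a::{real_inner,complete_space} \<Rightarrow> 'b::real_inner"
  assumes "bounded_linear A"
  shows "u \<bullet> adjoint A v = A u \<bullet> v"
proof -
  interpret A: bounded_linear A by fact
  have "\<exists>a. \<forall>u. A u \<bullet> v = u \<bullet> a" for v
    by (rule riesz_representation)
      (rule bounded_linear_compose[OF bounded_linear_inner_left assms])
  then obtain A' where "\<And>u v. A u \<bullet> v = u \<bullet> A' v"
    by metis
  moreover from this have "adjoint A = A'"
    by (intro adjoint_unique) blast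
  ultimately show ?thesis by simp
qed

section \<open>Growth of functions whose derivative is controlled by
  \<open>\<beta> * \<epsilon>\<close>\<close>

lemma integral_has_real_derivative_interior:
  fixes f :: "real \<Rightarrow> real"
  assumes "continuous_on {a..} f" and "a < u"
  shows "((\<lambda>v. integral {a..v} f) has_real_derivative f u) (at u)"
proof -
  \<comment> \<open>Extending the interval past \<open>u\<close> makes \<open>u\<close> an interior
    point, so the derivative is two-sided.\<close>
  have "continuous_on {a..u + 1} f"
    using assms(1) by (rule continuous_on_subset) auto
  from integral_has_real_derivative[OF this, of u]
  have "((\<lambda>v. integral {a..v} f) has_real_derivative f u) (at u within {a..u + 1})"
    using assms(2) by auto
  moreover have "at u within {a..u + 1} = at u"
    using assms(2) by (intro at_within_interior) auto
  ultimately show ?thesis by simp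
qed

text \<open>A continuous form of Kronecker's lemma: the integral of \<open>\<beta> * \<epsilon>\<close> may diverge, but it is
  \<open>o(\<beta>)\<close>, since from a late time \<open>s\<close> on it is at most \<open>\<beta> t\<close> times a small tail of the integral
  of \<open>\<epsilon>\<close>.\<close>

lemma eventually_quotient_less:
  fixes E \<beta> \<epsilon> :: "real \<Rightarrow> real"
  assumes deriv: "\<And>t. t > t0 \<Longrightarrow> (E has_real_derivative E' t) (at t)"
    and deriv_le: "\<And>t. t > t0 \<Longrightarrow> E' t \<le> c * \<beta> t * \<epsilon> t"
    and c: "c \<ge> 0"
    and \<beta>_pos: "\<And>t. t \<ge> t0 \<Longrightarrow> \<beta> t > 0" and \<beta>_mono: "mono_on {t0..} \<beta>"
    and \<beta>_lim: "filterlim \<beta> at_top at_top"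
    and \<epsilon>_nonneg: "\<And>t. t \<ge> t0 \<Longrightarrow> \<epsilon> t \<ge> 0" and \<epsilon>_cont: "continuous_on {t0..} \<epsilon>"
    and \<epsilon>_int: "\<epsilon> integrable_on {t0..}"
    and \<eta>: "\<eta> > 0"
  shows "\<forall>\<^sub>F t in at_top. E t / \<beta> t < \<eta>"
proof -
  define H where "H u = integral {t0..u} \<epsilon>" for u
  have H_le: "H u \<le> integral {t0..} \<epsilon>" for u
    unfolding H_def
    by (rule integral_subset_le)
      (auto intro!: \<epsilon>_int \<epsilon>_nonneg integrable_continuous_real
        intro: continuous_on_subset[OF \<epsilon>_cont])
  have bdd: "bdd_above (H ` {t0<..})"
    using H_le by (intro bdd_aboveI2)
  \<comment> \<open>As \<open>H\<close> stays below \<open>S\<close>, choosing \<open>s\<close> with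
    \<open>H s\<close> within \<open>\<kappa>\<close> of \<open>S\<close> keeps all later increments
    \<open>H t - H s\<close> at most \<open>\<kappa>\<close>.\<close>
  define S where "S = Sup (H ` {t0<..})"
  \<comment> \<open>Chosen so that \<open>c * \<kappa>\<close> is at most \<open>\<eta> / 2\<close>;
    the added 1 keeps the denominator positive when \<open>c = 0\<close>.\<close>
  define \<kappa> where "\<kappa> = \<eta> / (2 * (c + 1))"
  have "\<kappa> > 0" using \<eta> c by (simp add: \<kappa>_def)
  then have "S - \<kappa> < S" by simp
  then obtain s where s: "s > t0" "S - \<kappa> < H s"
    unfolding S_def using less_cSupD[of "H ` {t0<..}" "Sup (H ` {t0<..}) - \<kappa>"] by auto
  have growth: "E t \<le> E s + c * \<beta> t * (H t - H s)" if t: "t \<ge> s" for t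
  proof -
    \<comment> \<open>With \<open>t\<close> frozen, monotonicity replaces \<open>\<beta> u\<close>
      by the constant \<open>\<beta> t\<close>, which makes this combination nonincreasing between
      \<open>s\<close> and \<open>t\<close>.\<close>
    have "E t - c * \<beta> t * H t \<le> E s - c * \<beta> t * H s"
    proof (rule DERIV_nonpos_imp_nonincreasing[OF t])
      fix u assume u: "s \<le> u" "u \<le> t"
      have "((\<lambda>u. E u - c * \<beta> t * H u) has_real_derivative (E' u - c * \<beta> t * \<epsilon> u)) (at u)"
        unfolding H_def
        using u s by (auto intro!: derivative_eq_intros deriv
            integral_has_real_derivative_interior[OF \<epsilon>_cont])
      moreover have "c * \<beta> u * \<epsilon> u \<le> c * \<beta> t * \<epsilon> u"
        using u s c \<epsilon>_nonneg[of u] mono_onD[OF \<beta>_mono, of u t]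
        by (intro mult_right_mono mult_left_mono) auto
      ultimately show "\<exists>D. ((\<lambda>u. E u - c * \<beta> t * H u) has_real_derivative D) (at u) \<and> D \<le> 0"
        using deriv_le[of u] u s by force
    qed
    then show ?thesis by (simp add: algebra_simps)
  qed
  \<comment> \<open>One half of \<open>\<eta>\<close> pays for the initial energy
    \<open>E s\<close>, the other for the growth term.\<close>
  have "\<forall>\<^sub>F t in at_top. \<beta> t > 2 * E s / \<eta>"
    using \<beta>_lim by (simp add: filterlim_at_top_dense)
  then show ?thesis
    using eventually_ge_at_top[of s]
  proof eventually_elim
    case (elim t)
    have \<beta>t: "\<beta> t > 0" using elim s \<beta>_pos by auto
    have "H t \<le> S"
      unfolding S_def using elim s by (intro cSup_upper bdd) auto
    then have "H t - H s \<le> \<kappa>" using s by simp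
    then have "c * (H t - H s) \<le> c * \<kappa>"
      using c by (rule mult_left_mono)
    also have "\<dots> \<le> \<eta> / 2"
      using c \<eta> by (simp add: \<kappa>_def field_simps)
    finally have "c * (H t - H s) * \<beta> t \<le> \<eta> / 2 * \<beta> t"
      using \<beta>t by (intro mult_right_mono) auto
    moreover have "E s < \<eta> / 2 * \<beta> t"
      using elim \<eta> by (simp add: field_simps)
    ultimately have "E t < \<eta> * \<beta> t"
      using growth[of t] elim by (simp add: algebra_simps)
    then show ?case using \<beta>t by (simp add: field_simps)
  qed
qed

section \<open>Energy estimate for an abstract primal-dual flow\<close>

lemma has_real_derivative_inner:
  fixes u v :: "real \<Rightarrow> 'a::real_inner"
  assumes "(u has_vector_derivative u') (at t)" "(v has_vector_derivative v') (at t)"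
  shows "((\<lambda>t. u t \<bullet> v t) has_real_derivative (u t \<bullet> v' + u' \<bullet> v t)) (at t)"
  using bounded_bilinear.has_vector_derivative[OF bounded_bilinear_inner assms]
  by (simp add: has_real_derivative_iff_has_vector_derivative)

lemma has_real_derivative_compose_gderiv:
  assumes "GDERIV f (u t) :> D" "(u has_vector_derivative u') (at t)"
  shows "((\<lambda>t. f (u t)) has_real_derivative u' \<bullet> D) (at t)"
  using has_derivative_compose[OF assms(2)[unfolded has_vector_derivative_def]
      assms(1)[unfolded gderiv_def]]
  by (simp add: has_field_derivative_def mult_commute_abs)

text \<open>Both primal variables are merged into \<open>X\<close>, and \<open>w\<close> is the
  multiplier error. Convexity enters only through \<open>P_le\<close>, and \<open>K'\<close> acts as
  the adjoint of \<open>K\<close>, which lets the primal and dual coupling terms cancel in the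
  energy.\<close>

lemma primal_dual_flow_tendsto:
  fixes P :: "'h::real_inner \<Rightarrow> real" and G :: "'h \<Rightarrow> 'h"
    and K :: "'h \<Rightarrow> 'z::real_inner" and K' :: "'z \<Rightarrow> 'h"
    and X V :: "real \<Rightarrow> 'h" and w :: "real \<Rightarrow> 'z" and \<beta> \<beta>' \<epsilon> \<epsilon>' :: "real \<Rightarrow> real"
  assumes P_nonneg: "\<And>u. P u \<ge> 0"
    and P_gderiv: "\<And>u. GDERIV P u :> G u"
    and P_le: "\<And>u. P u \<le> (u - p) \<bullet> G u"
    and adj: "\<And>u z. u \<bullet> K' z = K u \<bullet> z"
    and X: "\<And>t. t > t0 \<Longrightarrow> (X has_vector_derivative V t) (at t)"
    and V: "\<And>t. t > t0 \<Longrightarrow> (V has_vector_derivative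
              - (\<gamma> *\<^sub>R V t + \<beta> t *\<^sub>R (G (X t) + K' (w t) + \<epsilon> t *\<^sub>R X t))) (at t)"
    and w: "\<And>t. t > t0 \<Longrightarrow> (w has_vector_derivative \<beta> t *\<^sub>R K (X t - p + \<delta> *\<^sub>R V t)) (at t)"
    and \<delta>: "\<delta> > 0" and \<delta>_\<gamma>: "1 / \<delta> \<le> \<gamma>"
    and \<beta>_pos: "\<And>t. t \<ge> t0 \<Longrightarrow> \<beta> t > 0" and \<beta>_mono: "mono_on {t0..} \<beta>"
    and \<beta>_lim: "filterlim \<beta> at_top at_top"
    and \<beta>_deriv: "\<And>t. t > t0 \<Longrightarrow> (\<beta> has_real_derivative \<beta>' t) (at t)"
    and \<beta>'_le: "\<And>t. t > t0 \<Longrightarrow> \<beta>' t \<le> 1 / \<delta> * \<beta> t"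
    and \<epsilon>_nonneg: "\<And>t. t \<ge> t0 \<Longrightarrow> \<epsilon> t \<ge> 0" and \<epsilon>_antimono: "antimono_on {t0..} \<epsilon>"
    and \<epsilon>_deriv: "\<And>t. t > t0 \<Longrightarrow> (\<epsilon> has_real_derivative \<epsilon>' t) (at t)"
    and \<epsilon>_cont: "continuous_on {t0..} \<epsilon>" and \<epsilon>_int: "\<epsilon> integrable_on {t0..}"
  shows "((\<lambda>t. P (X t)) \<longlongrightarrow> 0) at_top"
proof -
  have \<delta>\<gamma>: "\<delta> * \<gamma> - 1 \<ge> 0"
    using \<delta> \<delta>_\<gamma> by (simp add: field_simps)
  \<comment> \<open>The extrapolated error that drives \<open>w\<close>, with the same weight
    \<open>\<delta>\<close> on the velocity.\<close>
  define U where "U t = X t - p + \<delta> *\<^sub>R V t" for t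
  define F where "F t = P (X t) + \<epsilon> t / 2 * (X t \<bullet> X t)" for t
  define E where "E t = \<delta>\<^sup>2 * (\<beta> t * F t) + 1/2 * (U t \<bullet> U t)
    + (\<delta> * \<gamma> - 1) / 2 * ((X t - p) \<bullet> (X t - p)) + \<delta> / 2 * (w t \<bullet> w t)" for t
  define E' where "E' t = \<delta>\<^sup>2 * \<beta>' t * F t + \<delta>\<^sup>2 * \<beta> t * \<epsilon>' t / 2 * (X t \<bullet> X t)
    - \<delta> * (\<delta> * \<gamma> - 1) * (V t \<bullet> V t) - \<delta> * \<beta> t * ((X t - p) \<bullet> (G (X t) + \<epsilon> t *\<^sub>R X t))" for t
  have E: "(E has_real_derivative E' t) (at t)" if t: "t > t0" for t
  proof -
    define Q where "Q = G (X t) + \<epsilon> t *\<^sub>R X t"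
    define U' where "U' = (1 - \<delta> * \<gamma>) *\<^sub>R V t - (\<delta> * \<beta> t) *\<^sub>R (Q + K' (w t))"
    have Xp: "((\<lambda>t. X t - p) has_vector_derivative V t) (at t)"
      using X[OF t] by (auto intro!: derivative_eq_intros)
    have "(U has_vector_derivative V t + \<delta> *\<^sub>R
        - (\<gamma> *\<^sub>R V t + \<beta> t *\<^sub>R (G (X t) + K' (w t) + \<epsilon> t *\<^sub>R X t))) (at t)"
      unfolding U_def
      by (intro has_vector_derivative_add Xp
          bounded_linear.has_vector_derivative[OF bounded_linear_scaleR_right] V t)
    also have "V t + \<delta> *\<^sub>R - (\<gamma> *\<^sub>R V t + \<beta> t *\<^sub>R (G (X t) + K' (w t) + \<epsilon> t *\<^sub>R X t)) = U'"
      by (simp add: U'_def Q_def algebra_simps)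
    finally have U: "(U has_vector_derivative U') (at t)" .
    have w': "(w has_vector_derivative \<beta> t *\<^sub>R K (U t)) (at t)"
      using w[OF t] by (simp add: U_def)
    have "(E has_real_derivative
        \<delta>\<^sup>2 * (\<beta>' t * F t + \<beta> t * (V t \<bullet> G (X t) + \<epsilon>' t / 2 * (X t \<bullet> X t) + \<epsilon> t * (V t \<bullet> X t)))
        + U t \<bullet> U' + (\<delta> * \<gamma> - 1) * ((X t - p) \<bullet> V t) + \<delta> * \<beta> t * (K (U t) \<bullet> w t)) (at t)"
      unfolding E_def F_def
      by (rule derivative_eq_intros has_real_derivative_inner U Xp \<beta>_deriv t \<epsilon>_deriv
          has_real_derivative_compose_gderiv[OF P_gderiv] X w' refl
          zero_neq_numeral[symmetric])+
        (simp add: F_def inner_commute add_divide_distrib diff_divide_distrib algebra_simps)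
    \<comment> \<open>The coupling term here cancels the derivative of
      \<open>\<delta> / 2 * (w t \<bullet> w t)\<close>.\<close>
    moreover have "U t \<bullet> U' = (1 - \<delta> * \<gamma>) * (U t \<bullet> V t) - \<delta> * \<beta> t * (U t \<bullet> Q + K (U t) \<bullet> w t)"
      by (simp add: U'_def inner_diff_right inner_add_right adj)
    \<comment> \<open>The part with factor \<open>\<delta>\<close> cancels the change of
      \<open>P\<close> and of the squared norm of \<open>X\<close> along the velocity.\<close>
    moreover have "U t \<bullet> Q = (X t - p) \<bullet> Q + \<delta> * (V t \<bullet> G (X t) + \<epsilon> t * (V t \<bullet> X t))"
      by (simp add: U_def Q_def inner_add_left inner_add_right algebra_simps)
    \<comment> \<open>The first summand cancels the derivative of the term in
      \<open>(X t - p) \<bullet> (X t - p)\<close>; the second leaves the damping in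
      \<open>E'\<close>.\<close>
    moreover have "U t \<bullet> V t = (X t - p) \<bullet> V t + \<delta> * (V t \<bullet> V t)"
      by (simp add: U_def inner_add_left)
    ultimately show ?thesis
      unfolding E'_def Q_def[symmetric] by (simp add: algebra_simps power2_eq_square)
  qed
  have E'_le: "E' t \<le> \<delta> / 2 * (p \<bullet> p) * \<beta> t * \<epsilon> t" if t: "t > t0" for t
  proof -
    have \<beta>: "\<beta> t > 0" and \<epsilon>: "\<epsilon> t \<ge> 0" using t \<beta>_pos \<epsilon>_nonneg by auto
    have "mono_on {t0..} (\<lambda>t. - \<epsilon> t)"
      using \<epsilon>_antimono by (auto simp: monotone_on_def)
    from mono_on_imp_deriv_nonneg[OF this DERIV_minus[OF \<epsilon>_deriv[OF t]]]
    have \<epsilon>': "\<epsilon>' t \<le> 0" using t by simp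
    have F: "F t \<ge> 0"
      using \<epsilon> P_nonneg by (simp add: F_def)
    \<comment> \<open>Convexity of half the squared norm, tested at \<open>p\<close>; this is the
      source of the error term with \<open>p \<bullet> p\<close>.\<close>
    have "2 * (p \<bullet> X t) \<le> X t \<bullet> X t + p \<bullet> p"
      using inner_ge_zero[of "X t - p"] by (simp add: algebra_simps inner_commute)
    then have "(X t \<bullet> X t - p \<bullet> p) / 2 \<le> (X t - p) \<bullet> X t"
      by (simp add: inner_diff_left)
    from mult_left_mono[OF this \<epsilon>]
    have "F t - \<epsilon> t / 2 * (p \<bullet> p) \<le> (X t - p) \<bullet> (G (X t) + \<epsilon> t *\<^sub>R X t)"
      using P_le[of "X t"] by (simp add: F_def inner_add_right diff_divide_distrib algebra_simps)
    then have "\<delta> * \<beta> t * (F t - \<epsilon> t / 2 * (p \<bullet> p))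
        \<le> \<delta> * \<beta> t * ((X t - p) \<bullet> (G (X t) + \<epsilon> t *\<^sub>R X t))"
      using \<delta> \<beta> by (intro mult_left_mono) auto
    \<comment> \<open>The growth condition on \<open>\<beta>\<close> makes this contribution no
      larger than the decay \<open>\<delta> * \<beta> t * F t\<close> gained from convexity.\<close>
    moreover have "\<delta>\<^sup>2 * \<beta>' t * F t \<le> \<delta> * \<beta> t * F t"
      using \<beta>'_le[OF t] \<delta> F by (intro mult_right_mono) (auto simp: power2_eq_square field_simps)
    moreover have "\<delta>\<^sup>2 * \<beta> t * \<epsilon>' t / 2 * (X t \<bullet> X t) \<le> 0"
      using \<beta> \<epsilon>' by (simp add: mult_nonneg_nonpos mult_nonpos_nonneg)
    moreover have "\<delta> * (\<delta> * \<gamma> - 1) * (V t \<bullet> V t) \<ge> 0"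
      using \<delta> \<delta>\<gamma> by simp
    ultimately show ?thesis
      unfolding E'_def by (simp add: algebra_simps)
  qed
  have P_le_E: "\<delta>\<^sup>2 * P (X t) \<le> E t / \<beta> t" if t: "t \<ge> t0" for t
  proof -
    have \<beta>: "\<beta> t > 0" and \<epsilon>: "\<epsilon> t \<ge> 0" using t \<beta>_pos \<epsilon>_nonneg by auto
    have "\<delta>\<^sup>2 * (\<beta> t * P (X t)) \<le> \<delta>\<^sup>2 * (\<beta> t * F t)"
      using \<beta> \<epsilon> by (intro mult_left_mono) (auto simp: F_def)
    \<comment> \<open>The other summands of \<open>E\<close> are nonnegative, the one in
      \<open>X t - p\<close> because \<open>\<delta> * \<gamma> \<ge> 1\<close>.\<close>
    also have "\<dots> \<le> E t"
      using \<delta> \<delta>\<gamma> by (simp add: E_def)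
    finally show ?thesis using \<beta> by (simp add: field_simps)
  qed
  show ?thesis
  proof (rule order_tendstoI)
    fix a :: real assume "a < 0"
    then show "\<forall>\<^sub>F t in at_top. a < P (X t)"
      using P_nonneg by (intro always_eventually allI) (rule less_le_trans)
  next
    fix a :: real assume "0 < a"
    have "\<forall>\<^sub>F t in at_top. E t / \<beta> t < \<delta>\<^sup>2 * a"
      by (rule eventually_quotient_less[OF E E'_le])
        (use \<delta> \<open>0 < a\<close> \<beta>_pos \<beta>_mono \<beta>_lim \<epsilon>_nonneg \<epsilon>_cont \<epsilon>_int in auto)
    then show "\<forall>\<^sub>F t in at_top. P (X t) < a"
      using eventually_ge_at_top[of t0]
    proof eventually_elim
      case (elim t)
      then have "\<delta>\<^sup>2 * P (X t) < \<delta>\<^sup>2 * a"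
        using P_le_E[of t] by linarith
      then show ?case using \<delta> by simp
    qed
  qed
qed

section \<open>Adjoints, saddle points and the gradient of the augmented Lagrangian\<close>

lemma adjoint_add:
  fixes A :: "'a::{real_inner,complete_space} \<Rightarrow> 'b::real_inner"
  assumes "bounded_linear A"
  shows "adjoint A (u + v) = adjoint A u + adjoint A v"
proof -
  have "h \<bullet> adjoint A (u + v) = h \<bullet> (adjoint A u + adjoint A v)" for h
    by (simp add: inner_add_right inner_adjoint_right[OF assms])
  then show ?thesis
    using vector_eq_ldot by blast
qed

text \<open>Shifting the multiplier by the residual \<open>r\<close> raises the Lagrangian by
  \<open>r \<bullet> r\<close>, which the saddle inequality in the multiplier forbids unless
  \<open>r = 0\<close>.\<close>

lemma saddle_points_feasible:
  assumes "(xs, ys, ls) \<in> saddle_points f g A B b"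
  shows "A xs + B ys = b"
proof -
  define r where "r = A xs + B ys - b"
  have "aug_lagrangian f g A B b xs ys (ls + r) \<le> aug_lagrangian f g A B b xs ys ls"
    using assms by (auto simp: saddle_points_def)
  then have "r \<bullet> r \<le> 0"
    by (simp add: aug_lagrangian_def r_def[symmetric] inner_add_left)
  then have "r = 0"
    by (metis inner_eq_zero_iff inner_ge_zero order_antisym)
  then show ?thesis
    by (simp add: r_def)
qed

text \<open>The penalty differentiates to a pairing with the residual, just as the multiplier term
  does with \<open>l\<close>; hence the adjoints act on their sum \<open>z\<close>.\<close>

lemma GDERIV_aug_lagrangian:
  fixes f :: "'x::{real_inner,complete_space} \<Rightarrow> real"
    and g :: "'y::{real_inner,complete_space} \<Rightarrow> real"
    and A :: "'x \<Rightarrow> 'z::real_inner" and B :: "'y \<Rightarrow> 'z" and b l :: 'z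
  assumes A: "bounded_linear A" and B: "bounded_linear B"
    and f: "GDERIV f (fst u) :> D" and g: "GDERIV g (snd u) :> D'"
  defines "z \<equiv> l + (A (fst u) + B (snd u) - b)"
  shows "GDERIV (\<lambda>u. aug_lagrangian f g A B b (fst u) (snd u) l) u
    :> (D + adjoint A z, D' + adjoint B z)"
proof -
  have f': "((\<lambda>u. f (fst u)) has_derivative (\<lambda>h. fst h \<bullet> D)) (at u)"
    by (rule has_derivative_compose[OF has_derivative_fst[OF has_derivative_ident]
          f[unfolded gderiv_def]])
  have g': "((\<lambda>u. g (snd u)) has_derivative (\<lambda>h. snd h \<bullet> D')) (at u)"
    by (rule has_derivative_compose[OF has_derivative_snd[OF has_derivative_ident]
          g[unfolded gderiv_def]])
  have r': "((\<lambda>u. A (fst u) + B (snd u) - b) has_derivative (\<lambda>h. A (fst h) + B (snd h))) (at u)"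
    by (auto intro!: derivative_eq_intros bounded_linear.has_derivative[OF A]
        bounded_linear.has_derivative[OF B])
  show ?thesis
    unfolding gderiv_def aug_lagrangian_def power2_norm_eq_inner
    by (rule derivative_eq_intros f' g' r' refl)+
      (simp add: z_def fun_eq_iff inner_adjoint_right[OF A] inner_adjoint_right[OF B]
        inner_add_right inner_add_left inner_diff_right inner_diff_left inner_commute algebra_simps)
qed

section \<open>The system (DS) as an abstract flow on the product space\<close>

theorem theorem4p4:
  fixes f :: "'x::{real_inner,complete_space} \<Rightarrow> real"
    and g :: "'y::{real_inner,complete_space} \<Rightarrow> real"
    and A :: "'x \<Rightarrow> 'z::{real_inner,complete_space}"
    and B :: "'y \<Rightarrow> 'z"
    and b :: 'z
    and gradf :: "'x \<Rightarrow> 'x" and gradg :: "'y \<Rightarrow> 'y"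
    and l1 l2 t0 \<gamma> \<delta> :: real
    and \<beta> \<beta>' \<epsilon> \<epsilon>' :: "real \<Rightarrow> real"
    and x :: "real \<Rightarrow> 'x" and y :: "real \<Rightarrow> 'y" and l :: "real \<Rightarrow> 'z"
  assumes A: "bounded_linear A" and B: "bounded_linear B"
    and f_convex: "convex_on UNIV f" and g_convex: "convex_on UNIV g"
    and gradf: "\<And>u. GDERIV f u :> gradf u" and gradf_cont: "continuous_on UNIV gradf"
    and gradg: "\<And>v. GDERIV g v :> gradg v" and gradg_cont: "continuous_on UNIV gradg"
    and l1: "l1 > 0" and gradf_lipschitz: "l1-lipschitz_on UNIV gradf"
    and l2: "l2 > 0" and gradg_lipschitz: "l2-lipschitz_on UNIV gradg"
    and saddle_ex: "saddle_points f g A B b \<noteq> {}"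
    and t0: "t0 > 0" and \<gamma>: "\<gamma> > 0" and \<delta>: "\<delta> > 0"
    and \<beta>_pos: "\<And>t. t \<ge> t0 \<Longrightarrow> \<beta> t > 0" and \<beta>_mono: "mono_on {t0..} \<beta>"
    and \<beta>_deriv: "\<And>t. t \<ge> t0 \<Longrightarrow> (\<beta> has_real_derivative \<beta>' t) (at t within {t0..})"
    and \<beta>'_cont: "continuous_on {t0..} \<beta>'"
    and \<epsilon>_nonneg: "\<And>t. t \<ge> t0 \<Longrightarrow> \<epsilon> t \<ge> 0" and \<epsilon>_antimono: "antimono_on {t0..} \<epsilon>"
    and \<epsilon>_deriv: "\<And>t. t \<ge> t0 \<Longrightarrow> (\<epsilon> has_real_derivative \<epsilon>' t) (at t within {t0..})"
    and \<epsilon>'_cont: "continuous_on {t0..} \<epsilon>'"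
    and \<epsilon>_lim: "(\<epsilon> \<longlongrightarrow> 0) at_top"
    and \<epsilon>_integrable: "set_integrable lborel {t0..} \<epsilon>"
    and \<beta>_lim: "filterlim \<beta> at_top at_top"
    and \<beta>'_le: "\<And>t. t \<ge> t0 \<Longrightarrow> \<beta>' t \<le> 1 / \<delta> * \<beta> t"
    and \<delta>_\<gamma>: "1 / \<delta> \<le> \<gamma>"
    and solution: "DS_solution gradf gradg A B b t0 \<gamma> \<delta> \<beta> \<epsilon> x y l"
  shows "\<forall>(xs, ys, ls) \<in> saddle_points f g A B b.
    ((\<lambda>t. aug_lagrangian f g A B b (x t) (y t) ls)
       \<longlongrightarrow> aug_lagrangian f g A B b xs ys ls) at_top"
proof (rule ballI, clarify)
  fix xs ys ls
  assume saddle: "(xs, ys, ls) \<in> saddle_points f g A B b"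
  interpret A: bounded_linear A by fact
  interpret B: bounded_linear B by fact
  have feasible: "A xs + B ys = b"
    using saddle by (rule saddle_points_feasible)
  from solution obtain x' x'' y' y'' l' where sol: "\<forall>t\<ge>t0.
        (x has_vector_derivative x' t) (at t within {t0..}) \<and>
        (x' has_vector_derivative x'' t) (at t within {t0..}) \<and>
        (y has_vector_derivative y' t) (at t within {t0..}) \<and>
        (y' has_vector_derivative y'' t) (at t within {t0..}) \<and>
        (l has_vector_derivative l' t) (at t within {t0..}) \<and>
        x'' t + \<gamma> *\<^sub>R x' t
          + \<beta> t *\<^sub>R (gradf (x t) + adjoint A (l t) + adjoint A (A (x t) + B (y t) - b)
                    + \<epsilon> t *\<^sub>R x t) = 0 \<and>
        y'' t + \<gamma> *\<^sub>R y' t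
          + \<beta> t *\<^sub>R (gradg (y t) + adjoint B (l t) + adjoint B (A (x t) + B (y t) - b)
                    + \<epsilon> t *\<^sub>R y t) = 0 \<and>
        l' t - \<beta> t *\<^sub>R (A (x t + \<delta> *\<^sub>R x' t) + B (y t + \<delta> *\<^sub>R y' t) - b) = 0"
    unfolding DS_solution_def by blast
  \<comment> \<open>The abstract flow asks for derivatives only after \<open>t0\<close>, where
    one-sided and ordinary ones agree.\<close>
  have at_interior: "at t within {t0..} = at t" if "t > t0" for t
    using that by (intro at_within_interior) auto
  have derivs:
    "(x has_vector_derivative x' t) (at t)" "(x' has_vector_derivative x'' t) (at t)"
    "(y has_vector_derivative y' t) (at t)" "(y' has_vector_derivative y'' t) (at t)"
    "(l has_vector_derivative l' t) (at t)" if "t > t0" for t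
    using sol[rule_format, OF less_imp_le[OF that]] unfolding at_interior[OF that] by blast+
  define L where "L u = aug_lagrangian f g A B b (fst u) (snd u) ls" for u
  define K where "K u = A (fst u) + B (snd u)" for u
  \<comment> \<open>The inner product of pairs is the sum over components, so the componentwise
    adjoints form the adjoint of \<open>K\<close>.\<close>
  define K' where "K' z = (adjoint A z, adjoint B z)" for z
  define G where "G u = (gradf (fst u), gradg (snd u)) + K' (ls + (K u - b))" for u
  define p where "p = (xs, ys)"
  have K'_add: "K' (u + v) = K' u + K' v" for u v
    by (simp add: K'_def adjoint_add A B)
  have adj: "u \<bullet> K' z = K u \<bullet> z" for u z
    by (simp add: K'_def K_def inner_prod_def inner_adjoint_right A B inner_add_left)
  have \<epsilon>_cont: "continuous_on {t0..} \<epsilon>"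
    using \<epsilon>_deriv by (intro DERIV_continuous_on) auto
  have "((\<lambda>t. L (x t, y t) - L p) \<longlongrightarrow> 0) at_top"
  proof (rule primal_dual_flow_tendsto[where G = G and p = p and K = K and K' = K'
        and V = "\<lambda>t. (x' t, y' t)" and w = "\<lambda>t. l t - ls"])
    show "0 \<le> L u - L p" for u
      using saddle by (auto simp: saddle_points_def L_def p_def)
    show "GDERIV (\<lambda>u. L u - L p) u :> G u" for u
    proof (rule GDERIV_subst)
      show "GDERIV (\<lambda>u. L u - L p) u :> G u - 0"
        unfolding L_def
        by (intro GDERIV_diff GDERIV_const
            GDERIV_subst[OF GDERIV_aug_lagrangian[OF A B gradf gradg]])
          (simp add: G_def K_def K'_def)
    qed simp
    show "L u - L p \<le> (u - p) \<bullet> G u" for u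
    proof -
      define r where "r = K u - b"
      have Kup: "K (u - p) = r"
        using feasible by (simp add: K_def p_def r_def A.diff B.diff algebra_simps)
      have "(u - p) \<bullet> G u = (fst u - xs) \<bullet> gradf (fst u) + (snd u - ys) \<bullet> gradg (snd u)
          + r \<bullet> (ls + r)"
        unfolding G_def inner_add_right[of "u - p" "(_, _)"] adj Kup
        by (simp add: r_def p_def inner_prod_def)
      \<comment> \<open>Convexity is used with the tangent at \<open>u\<close>, evaluated at the
        saddle point.\<close>
      moreover have "f xs \<ge> f (fst u) + (xs - fst u) \<bullet> gradf (fst u)"
        by (rule convex_on_gderiv_inequality[OF f_convex gradf])
      moreover have "g ys \<ge> g (snd u) + (ys - snd u) \<bullet> gradg (snd u)"
        by (rule convex_on_gderiv_inequality[OF g_convex gradg])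
      moreover have "L u = f (fst u) + g (snd u) + r \<bullet> ls + 1/2 * (r \<bullet> r)"
        by (simp add: L_def aug_lagrangian_def r_def K_def power2_norm_eq_inner inner_commute)
      moreover have "L p = f xs + g ys"
        by (simp add: L_def p_def aug_lagrangian_def feasible)
      \<comment> \<open>The penalty puts \<open>r \<bullet> r\<close> into the gradient pairing but
        only half of it into \<open>L u\<close>; the surplus has the right sign.\<close>
      moreover have "r \<bullet> r \<ge> 0" by simp
      ultimately show ?thesis
        unfolding inner_diff_left inner_add_right by linarith
    qed
    show "u \<bullet> K' z = K u \<bullet> z" for u z
      by (rule adj)
    show "((\<lambda>t. (x t, y t)) has_vector_derivative (x' t, y' t)) (at t)" if "t > t0" for t
      using that by (intro has_vector_derivative_Pair derivs)
    show "((\<lambda>t. (x' t, y' t)) has_vector_derivative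
        - (\<gamma> *\<^sub>R (x' t, y' t) + \<beta> t *\<^sub>R (G (x t, y t) + K' (l t - ls) + \<epsilon> t *\<^sub>R (x t, y t)))) (at t)"
      if "t > t0" for t
    proof -
      \<comment> \<open>\<open>G\<close> carries the fixed multiplier \<open>ls\<close>; adding
        \<open>K'\<close> of the error restores the actual \<open>l t\<close> of (DS).\<close>
      have "K' (ls + (K (x t, y t) - b)) + K' (l t - ls) = K' (l t) + K' (K (x t, y t) - b)"
        by (simp add: algebra_simps flip: K'_add)
      then have "G (x t, y t) + K' (l t - ls)
          = (gradf (x t), gradg (y t)) + (K' (l t) + K' (K (x t, y t) - b))"
        by (simp add: G_def add.assoc)
      then have "(x'' t, y'' t)
          + (\<gamma> *\<^sub>R (x' t, y' t) + \<beta> t *\<^sub>R (G (x t, y t) + K' (l t - ls) + \<epsilon> t *\<^sub>R (x t, y t))) = 0"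
        using sol that by (simp add: K'_def K_def add.assoc zero_prod_def)
      then have "- (\<gamma> *\<^sub>R (x' t, y' t) + \<beta> t *\<^sub>R (G (x t, y t) + K' (l t - ls) + \<epsilon> t *\<^sub>R (x t, y t)))
          = (x'' t, y'' t)"
        by (simp only: eq_neg_iff_add_eq_0[symmetric])
      then show ?thesis
        using that by (simp only:) (intro has_vector_derivative_Pair derivs)
    qed
    show "((\<lambda>t. l t - ls) has_vector_derivative
        \<beta> t *\<^sub>R K ((x t, y t) - p + \<delta> *\<^sub>R (x' t, y' t))) (at t)" if "t > t0" for t
    proof -
      \<comment> \<open>Feasibility identifies \<open>b\<close> with \<open>K p\<close>, so the
        affine residual becomes linear in the error.\<close>
      have "K ((x t, y t) - p + \<delta> *\<^sub>R (x' t, y' t))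
          = A (x t + \<delta> *\<^sub>R x' t) + B (y t + \<delta> *\<^sub>R y' t) - (A xs + B ys)"
        by (simp add: K_def p_def A.diff A.add B.diff B.add)
      then have "\<beta> t *\<^sub>R K ((x t, y t) - p + \<delta> *\<^sub>R (x' t, y' t)) = l' t"
        using sol that by (simp add: feasible)
      then show ?thesis
        using derivs(5)[OF that] by (auto intro!: derivative_eq_intros)
    qed
    show "(\<beta> has_real_derivative \<beta>' t) (at t)" "(\<epsilon> has_real_derivative \<epsilon>' t) (at t)" if "t > t0" for t
      using \<beta>_deriv[of t] \<epsilon>_deriv[of t] that by (simp_all add: at_interior)
    show "\<epsilon> integrable_on {t0..}"
      using \<epsilon>_integrable by (rule set_borel_integral_eq_integral)
  qed (use \<delta> \<delta>_\<gamma> \<beta>_pos \<beta>_mono \<beta>_lim \<beta>'_le \<epsilon>_nonneg \<epsilon>_antimono \<epsilon>_cont in \<open>auto dest: less_imp_le\<close>)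
  then show "((\<lambda>t. aug_lagrangian f g A B b (x t) (y t) ls)
       \<longlongrightarrow> aug_lagrangian f g A B b xs ys ls) at_top"
    by (simp add: L_def p_def LIM_zero_iff)
qed

end
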